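(* Assume the following conjecture (Spiro–Verstraëte): for all integers $l\ge 3$ and $r\ge 2$, with $k=\lfloor l/2\rfloor$, the maximum number of hyperedges of an $n$-vertex $r$-uniform hypergraph of girth at least $l+1$ is $n^{1+1/k-o(1)}$. Then for all integers $k\ge 1$, $f\ge 1$, $r\ge 2$, there exist infinite families of undirected unweighted $n$-vertex $r$-uniform hypergraphs $H$ with $\Omega\!\left(f^{1-1/r-1/(rk)}\,n^{1+1/k-o(1)}\right)$ hyperedges such that every $f$-edge-fault-tolerant $(2k-1)$-hyperspanner of $H$ must contain all hyperedges of $H$.
   Context: A hypergraph $H=(V,E)$ is $r$-uniform if every hyperedge has exactly $r$ vertices; unweighted means every hyperedge has weight $1$. A path between $u$ and $v$ is a sequence of vertices $u=x_0,\dots,x_\ell=v$ with hyperedges $h_1,\dots,h_\ell$ such that $x_{j-1},x_j\in h_j$; its length is the sum of the weights of $h_1,\dots,h_\ell$, and $\delta_H(u,v)$ is the minimum length of a $u$–$v$ path. A (Berge) cycle of length $\ell\ge 2$ consists of distinct vertices $v_1,\dots,v_\ell$ and distinct hyperedges $h_1,\dots,h_\ell$ with $v_i,v_{i+1}\in h_i$ (indices mod $\ell$); the girth is the minimum length of a cycle. For $F\subseteq E$, $H\setminus F$ has hyperedge set $E\setminus F$. A sub-hypergraph $S=(V,E')$, $E'\subseteq E$, is an $f$-edge-fault-tolerant $t$-hyperspanner of $H$ if for all $u,v\in V$ and all $F\subseteq E$ with $|F|\le f$, $\delta_{S\setminus F}(u,v)\le t\cdot\delta_{H\setminus F}(u,v)$.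 *)

theory Defs
  imports Complex_Main "HOL-Library.Extended_Nat" "HOL-Library.Extended_Real"
begin

record 'a hypergraph =
  verts :: "'a set"
  hedges :: "'a set set"
  weight :: "'a set \<Rightarrow> real"

(* The weight function is only meaningful on the hyperedges. *)

definition hypergraph :: "'a hypergraph \<Rightarrow> bool" where
  "hypergraph H \<longleftrightarrow> finite (verts H) \<and> hedges H \<subseteq> Pow (verts H)"

definition uniform :: "nat \<Rightarrow> 'a hypergraph \<Rightarrow> bool" where
  "uniform r H \<longleftrightarrow> (\<forall>e \<in> hedges H. card e = r)"

definition unweighted :: "'a hypergraph \<Rightarrow> bool" where
  "unweighted H \<longleftrightarrow> (\<forall>e \<in> hedges H. weight H e = 1)"

definition hpath :: "'a hypergraph \<Rightarrow> 'a \<Rightarrow> 'a list \<Rightarrow> 'a set list \<Rightarrow> 'a \<Rightarrow> bool" where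
  "hpath H u xs hs v \<longleftrightarrow>
     length xs = Suc (length hs) \<and> hd xs = u \<and> last xs = v \<and>
     set xs \<subseteq> verts H \<and> set hs \<subseteq> hedges H \<and>
     (\<forall>j < length hs. xs ! j \<in> hs ! j \<and> xs ! Suc j \<in> hs ! j)"

(* The infimum over the empty set is infinity, so disconnected pairs are at infinite distance. *)

definition hdist :: "'a hypergraph \<Rightarrow> 'a \<Rightarrow> 'a \<Rightarrow> ereal" where
  "hdist H u v =
     Inf {ereal (sum_list (map (weight H) hs)) | xs hs. hpath H u xs hs v}"

definition berge_cycle :: "'a hypergraph \<Rightarrow> 'a list \<Rightarrow> 'a set list \<Rightarrow> bool" where
  "berge_cycle H vs hs \<longleftrightarrow>
     2 \<le> length vs \<and> length hs = length vs \<and> distinct vs \<and> distinct hs \<and>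
     set vs \<subseteq> verts H \<and> set hs \<subseteq> hedges H \<and>
     (\<forall>i < length vs. vs ! i \<in> hs ! i \<and> vs ! (Suc i mod length vs) \<in> hs ! i)"

(* Hypergraphs without a cycle have infinite girth. *)

definition girth :: "'a hypergraph \<Rightarrow> enat" where
  "girth H = Inf {enat (length vs) | vs hs. berge_cycle H vs hs}"

definition del_hedges :: "'a hypergraph \<Rightarrow> 'a set set \<Rightarrow> 'a hypergraph" where
  "del_hedges H F = H\<lparr>hedges := hedges H - F\<rparr>"

definition sub_hypergraph :: "'a hypergraph \<Rightarrow> 'a hypergraph \<Rightarrow> bool" where
  "sub_hypergraph S H \<longleftrightarrow>
     verts S = verts H \<and> hedges S \<subseteq> hedges H \<and> (\<forall>e \<in> hedges S. weight S e = weight H e)"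

definition ft_hyperspanner :: "nat \<Rightarrow> real \<Rightarrow> 'a hypergraph \<Rightarrow> 'a hypergraph \<Rightarrow> bool" where
  "ft_hyperspanner f t H S \<longleftrightarrow>
     sub_hypergraph S H \<and>
     (\<forall>u \<in> verts H. \<forall>v \<in> verts H. \<forall>F \<subseteq> hedges H. finite F \<and> card F \<le> f \<longrightarrow>
        hdist (del_hedges S F) u v \<le> ereal t * hdist (del_hedges H F) u v)"

definition max_hedges_girth :: "nat \<Rightarrow> nat \<Rightarrow> nat \<Rightarrow> nat" where
  "max_hedges_girth n r g =
     Max {card (hedges H) | H :: nat hypergraph.
            hypergraph H \<and> card (verts H) = n \<and> uniform r H \<and> enat g \<le> girth H}"

(* The o(1) term is a null sequence of unrestricted sign, which may depend on l and r. The equation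
   is required for all large n only: for small n the maximum can be 0, which is not a power of n. *)

definition spiro_verstraete_conjecture :: bool where
  "spiro_verstraete_conjecture \<longleftrightarrow>
     (\<forall>l \<ge> 3. \<forall>r \<ge> 2. \<exists>\<epsilon> :: nat \<Rightarrow> real. \<epsilon> \<longlonglongrightarrow> 0 \<and>
        (\<forall>\<^sub>F n in sequentially.
           real (max_hedges_girth n r (l + 1)) = real n powr (1 + 1 / real (l div 2) - \<epsilon> n)))"

end

(* The lower-bound hypergraph is a blow-up. Let B be a densest r-uniform hypergraph of girth at least
   2k + 2 on m vertices, and replace every vertex by t copies and every hyperedge by all t^r of its
   transversals. If a spanner S misses the copy h of a hyperedge h0 of B, let t^r - 1 faults destroy
   all other copies of h0. Then h still joins two of its vertices at distance 1, so S minus the faults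
   contains a path of length at most 2k - 1 between them, and its projection to B avoids h0; closed
   up by h0 it gives a cycle of length at most 2k in B, which is impossible. Taking t to be about
   f^(1/r) and m about n / t gives the claimed number of hyperedges. *)
theory Submission
  imports Defs "HOL-Library.FuncSet"
begin

section \<open>Paths and cycles\<close>

lemma hpath_Cons:
  "hpath H u (x # xs) (h # hs) v \<longleftrightarrow>
     x = u \<and> u \<in> verts H \<and> h \<in> hedges H \<and> u \<in> h \<and> hd xs \<in> h \<and> hpath H (hd xs) xs hs v"
  by (cases xs) (auto simp: hpath_def nth_Cons' less_Suc_eq_0_disj All_less_Suc2)

lemma hpath_drop:
  assumes "hpath H u xs hs v" "i \<le> length hs"
  shows "hpath H (xs ! i) (drop i xs) (drop i hs) v"
  using assms by (auto simp: hpath_def hd_drop_conv_nth Suc_diff_le dest: in_set_dropD)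

text \<open>A Berge cycle needs distinct vertices and distinct hyperedges, so both kinds of
  repetition are shortcut. In the induction, prepending \<open>u\<close> and \<open>h\<close> to an
  already reduced path can create only two repetitions: of \<open>u\<close> or of
  \<open>h\<close>.\<close>

lemma hpath_distinct:
  assumes "hpath H u xs hs v"
  shows "\<exists>ys gs. hpath H u ys gs v \<and> distinct ys \<and> distinct gs \<and> length gs \<le> length hs"
  using assms
proof (induction hs arbitrary: u xs)
  case Nil
  then have "distinct xs"
    by (cases xs) (auto simp: hpath_def)
  with Nil show ?case by (intro exI[of _ xs] exI[of _ "[]"]) simp
next
  case (Cons h hs)
  then obtain xs' where xs: "xs = u # xs'"
    by (cases xs) (auto simp: hpath_def)
  with Cons.prems have u: "u \<in> verts H" "h \<in> hedges H" "u \<in> h" "hd xs' \<in> h"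
    and p: "hpath H (hd xs') xs' hs v"
    by (auto simp: hpath_Cons)
  from Cons.IH[OF p] obtain ys gs where q: "hpath H (hd xs') ys gs v" "distinct ys" "distinct gs"
    "length gs \<le> length hs" by blast
  have len: "length ys = Suc (length gs)" and hd: "hd ys = hd xs'"
    using q by (auto simp: hpath_def)
  show ?case
  proof (cases "u \<in> set ys")
    case True
    then obtain i where i: "i < length ys" "ys ! i = u"
      by (auto simp: in_set_conv_nth)
    with hpath_drop[OF q(1), of i] q len show ?thesis
      by (intro exI[of _ "drop i ys"] exI[of _ "drop i gs"]) auto
  next
    case False
    show ?thesis
    proof (cases "h \<in> set gs")
      case True
      then obtain j where j: "j < length gs" "gs ! j = h"
        by (auto simp: in_set_conv_nth)
      have "hpath H (ys ! Suc j) (drop (Suc j) ys) (drop (Suc j) gs) v"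
        using hpath_drop[OF q(1), of "Suc j"] j by simp
      moreover have "ys ! Suc j \<in> h"
        using q(1) j by (auto simp: hpath_def)
      moreover have "hd (drop (Suc j) ys) = ys ! Suc j"
        using j len by (simp add: hd_drop_conv_nth)
      ultimately have "hpath H u (u # drop (Suc j) ys) (h # drop (Suc j) gs) v"
        using u by (simp add: hpath_Cons)
      \<comment> \<open>\<open>h\<close> leads directly from \<open>u\<close> to the vertex after
        its later occurrence. The new hyperedge list is then a suffix of \<open>gs\<close>, so it
        inherits distinctness and the length bound.\<close>
      moreover have "h # drop (Suc j) gs = drop j gs"
        using Cons_nth_drop_Suc[of j gs] j by simp
      ultimately have "hpath H u (u # drop (Suc j) ys) (drop j gs) v" by simp
      moreover have "distinct (u # drop (Suc j) ys)"
        using False q(2) set_drop_subset[of "Suc j" ys] by auto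
      ultimately show ?thesis
        using q by (intro exI[of _ "u # drop (Suc j) ys"] exI[of _ "drop j gs"]) auto
    next
      case False': False
      have "hpath H u (u # ys) (h # gs) v"
        using u q hd by (simp add: hpath_Cons)
      then show ?thesis
        using False False' q by (intro exI[of _ "u # ys"] exI[of _ "h # gs"]) auto
    qed
  qed
qed

text \<open>Reduce the path to one without repetitions and close it up by \<open>h\<close>. The
  hyperedges stay distinct because the path avoids \<open>h\<close>, and \<open>u \<noteq> v\<close>
  rules out the empty path, so the cycle has length at least 2.\<close>

lemma girth_le_hpath:
  assumes p: "hpath (del_hedges H {h}) u xs hs v"
    and h: "h \<in> hedges H" "u \<in> h" "v \<in> h" "u \<noteq> v"
  shows "girth H \<le> enat (Suc (length hs))"
proof -
  from hpath_distinct[OF p] obtain ys gs where q: "hpath (del_hedges H {h}) u ys gs v"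
    and d: "distinct ys" "distinct gs" and le: "length gs \<le> length hs" by blast
  from q have len: "length ys = Suc (length gs)" and ends: "hd ys = u" "last ys = v"
    and sub: "set ys \<subseteq> verts H" "set gs \<subseteq> hedges H - {h}"
    and inc: "\<forall>j < length gs. ys ! j \<in> gs ! j \<and> ys ! Suc j \<in> gs ! j"
    by (auto simp: hpath_def del_hedges_def)
  have "gs \<noteq> []"
    using len ends h by (cases ys) auto
  have "ys \<noteq> []" using len by auto
  then have ys0: "ys ! 0 = u" "ys ! length gs = v"
    using hd_conv_nth[of ys] last_conv_nth[of ys] len ends by simp_all
  have "berge_cycle H ys (gs @ [h])"
    unfolding berge_cycle_def
  proof (intro conjI allI impI)
    show "2 \<le> length ys" using \<open>gs \<noteq> []\<close> len by (cases gs) auto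
    fix i assume "i < length ys"
    \<comment> \<open>At the last index the successor wraps around to 0: there \<open>h\<close>
      joins \<open>v\<close> back to \<open>u\<close>.\<close>
    then consider "i < length gs" | "i = length gs" using len by linarith
    then show "ys ! i \<in> (gs @ [h]) ! i" "ys ! (Suc i mod length ys) \<in> (gs @ [h]) ! i"
      using inc ys0 h len by (cases; simp add: nth_append)+
  qed (use len d sub h in auto)
  then have "girth H \<le> enat (length ys)"
    unfolding girth_def by (blast intro: Inf_lower)
  also have "\<dots> \<le> enat (Suc (length hs))" using len le by simp
  finally show ?thesis .
qed

lemma hdist_le_1:
  assumes "e \<in> hedges H" "weight H e = 1" "u \<in> e" "v \<in> e" "u \<in> verts H" "v \<in> verts H"
  shows "hdist H u v \<le> 1"
proof -
  have "hpath H u [u, v] [e] v"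
    using assms by (auto simp: hpath_def)
  then have "hdist H u v \<le> ereal (sum_list (map (weight H) [e]))"
    unfolding hdist_def by (intro Inf_lower) blast
  then show ?thesis using assms by (simp add: one_ereal_def)
qed

text \<open>The strict bound provides a witness: an infimum below \<open>L\<close> has an element
  below \<open>L\<close>, whether or not it is attained.\<close>

lemma hpath_of_hdist_less:
  assumes "unweighted H" "hdist H u v < ereal L"
  shows "\<exists>xs hs. hpath H u xs hs v \<and> real (length hs) < L"
proof -
  from assms(2) obtain xs hs where p: "hpath H u xs hs v"
    and w: "sum_list (map (weight H) hs) < L"
    by (auto simp: hdist_def Inf_less_iff)
  have "map (weight H) hs = map (\<lambda>_. 1) hs"
    using p assms(1) by (auto simp: hpath_def unweighted_def)
  then have "sum_list (map (weight H) hs) = real (length hs)"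
    by (simp only: sum_list_triv mult_1_right)
  with p w show ?thesis by auto
qed

section \<open>Blow-ups\<close>

text \<open>The \<open>t\<close> copies of a vertex \<open>w\<close> are the numbers \<open>x\<close> with \<open>x div t = w\<close>. The blow-up takes its
  vertex set as a parameter, which leaves room for isolated vertices.\<close>

definition blowup :: "nat \<Rightarrow> nat set \<Rightarrow> nat hypergraph \<Rightarrow> nat hypergraph" where
  "blowup t V B = \<lparr>verts = V,
     hedges = {e. inj_on (\<lambda>x. x div t) e \<and> (\<lambda>x. x div t) ` e \<in> hedges B}, weight = (\<lambda>_. 1)\<rparr>"

lemma blowup_simps [simp]:
  "verts (blowup t V B) = V"
  "hedges (blowup t V B) = {e. inj_on (\<lambda>x. x div t) e \<and> (\<lambda>x. x div t) ` e \<in> hedges B}"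
  "weight (blowup t V B) = (\<lambda>_. 1)"
  by (simp_all add: blowup_def)

lemma div_vimage_eq:
  fixes t :: nat
  assumes "0 < t"
  shows "{x. x div t \<in> W} = (\<lambda>(w, i). w * t + i) ` (W \<times> {..<t})"
proof (intro equalityI subsetI)
  fix x assume "x \<in> {x. x div t \<in> W}"
  then show "x \<in> (\<lambda>(w, i). w * t + i) ` (W \<times> {..<t})"
    using assms by (intro image_eqI[of _ _ "(x div t, x mod t)"]) auto
qed (use assms in auto)

lemma
  fixes t :: nat
  assumes "0 < t" "finite W"
  shows finite_div_vimage: "finite {x. x div t \<in> W}"
    and card_div_vimage: "card {x. x div t \<in> W} = card W * t"
proof -
  have "inj_on (\<lambda>(w, i). w * t + i) (W \<times> {..<t})"
    by (rule inj_on_inverseI[of _ "\<lambda>x. (x div t, x mod t)"]) auto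
  then show "card {x. x div t \<in> W} = card W * t"
    by (simp add: div_vimage_eq[OF assms(1)] card_image card_cartesian_product)
  show "finite {x. x div t \<in> W}"
    using assms by (simp add: div_vimage_eq)
qed

text \<open>A transversal amounts to an independent choice of a remainder modulo \<open>t\<close>
  for each vertex of \<open>h\<close>, hence to a function from \<open>h\<close> to
  \<open>{..<t}\<close>.\<close>

lemma
  fixes t :: nat
  assumes t: "0 < t" and h: "finite h"
  shows finite_transversals: "finite {e. inj_on (\<lambda>x. x div t) e \<and> (\<lambda>x. x div t) ` e = h}"
    and card_transversals: "card {e. inj_on (\<lambda>x. x div t) e \<and> (\<lambda>x. x div t) ` e = h} = t ^ card h"
proof -
  let ?E = "{e. inj_on (\<lambda>x. x div t) e \<and> (\<lambda>x. x div t) ` e = h}"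
  let ?G = "h \<rightarrow>\<^sub>E {..<t}"
  let ?lift = "\<lambda>g. (\<lambda>w. w * t + g w) ` h"
  have div: "(w * t + g w) div t = w" and "mod": "(w * t + g w) mod t = g w"
    if "g \<in> ?G" "w \<in> h" for g w
    using that t by (auto dest!: PiE_mem)
  have bij: "bij_betw ?lift ?G ?E"
  proof (intro bij_betw_imageI)
    show "inj_on ?lift ?G"
    proof (rule inj_onI)
      fix g g' assume g: "g \<in> ?G" "g' \<in> ?G" and eq: "?lift g = ?lift g'"
      show "g = g'"
      proof (rule PiE_ext[OF g])
        fix w assume w: "w \<in> h"
        then have "w * t + g w \<in> ?lift g'" unfolding eq[symmetric] by blast
        then obtain w' where w': "w' \<in> h" "w * t + g w = w' * t + g' w'" by blast
        then have "w = w'" using div[OF g(1) w] div[OF g(2) w'(1)] by simp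
        then show "g w = g' w" using w' by simp
      qed
    qed
    show "?lift ` ?G = ?E"
    proof (intro equalityI subsetI)
      fix e assume "e \<in> ?lift ` ?G"
      then obtain g where g: "g \<in> ?G" "e = ?lift g" by blast
      have "(\<lambda>x. x div t) ` e = (\<lambda>w. (w * t + g w) div t) ` h"
        unfolding g(2) image_image ..
      also have "\<dots> = (\<lambda>w. w) ` h" using div[OF g(1)] by (intro image_cong) auto
      finally have "(\<lambda>x. x div t) ` e = h" by simp
      moreover have "inj_on (\<lambda>x. x div t) e"
        unfolding g(2) by (rule inj_onI) (use div[OF g(1)] in auto)
      ultimately show "e \<in> ?E" by blast
    next
      fix e assume "e \<in> ?E"
      then have inj: "inj_on (\<lambda>x. x div t) e" and im: "(\<lambda>x. x div t) ` e = h" by auto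
      \<comment> \<open>Each \<open>w\<close> in \<open>h\<close> has exactly one copy in
        \<open>e\<close>; its remainder is the choice made at \<open>w\<close>. The restriction
        makes \<open>g\<close> extensional, as membership in \<open>?G\<close> demands.\<close>
      define g where "g = restrict (\<lambda>w. the_inv_into e (\<lambda>x. x div t) w mod t) h"
      have "g \<in> ?G" unfolding g_def using t by auto
      moreover have "?lift g = e"
      proof -
        have "?lift g = (\<lambda>x. (x div t) * t + g (x div t)) ` e"
          unfolding im[symmetric] image_image ..
        also have "\<dots> = (\<lambda>x. x) ` e"
        proof (rule image_cong)
          fix x assume "x \<in> e"
          then have "g (x div t) = x mod t"
            using im by (auto simp: g_def the_inv_into_f_f[OF inj])
          then show "x div t * t + g (x div t) = x" by simp
        qed simp
        finally show ?thesis by simp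
      qed
      ultimately show "e \<in> ?lift ` ?G" by blast
    qed
  qed
  have G: "finite ?G" "card ?G = t ^ card h"
    using h by (simp_all add: finite_PiE card_PiE)
  show "finite ?E" using bij_betw_finite[OF bij] G(1) by blast
  show "card ?E = t ^ card h" using bij_betw_same_card[OF bij] G(2) by simp
qed

lemma hypergraph_blowup:
  assumes "hypergraph B" "finite V" "{x. x div t \<in> verts B} \<subseteq> V"
  shows "hypergraph (blowup t V B)"
  using assms unfolding hypergraph_def by fastforce

lemma uniform_blowup:
  assumes "uniform r B"
  shows "uniform r (blowup t V B)"
  using assms by (auto simp: uniform_def dest!: card_image)

text \<open>Sort the hyperedges by their projections: the fibres are disjoint, and each consists of
  the transversals over one hyperedge of \<open>B\<close>.\<close>

lemma card_hedges_blowup: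
  assumes t: "0 < t" and B: "hypergraph B" "uniform r B"
  shows "card (hedges (blowup t V B)) = card (hedges B) * t ^ r"
proof -
  let ?E = "\<lambda>h. {e. inj_on (\<lambda>x. x div t) e \<and> (\<lambda>x. x div t) ` e = h}"
  have finB: "finite (hedges B)"
    using B by (auto simp: hypergraph_def intro: finite_subset)
  have fin: "finite h" if "h \<in> hedges B" for h
    using B that by (auto simp: hypergraph_def intro: finite_subset)
  have "hedges (blowup t V B) = (\<Union>h \<in> hedges B. ?E h)" by auto
  also have "card \<dots> = (\<Sum>h \<in> hedges B. card (?E h))"
    using finB fin finite_transversals[OF t] by (intro card_UN_disjoint) auto
  also have "\<dots> = (\<Sum>h \<in> hedges B. t ^ r)"
    using fin B card_transversals[OF t] by (intro sum.cong) (auto simp: uniform_def)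
  finally show ?thesis by simp
qed

section \<open>Every hyperedge of a blow-up is indispensable\<close>

lemma hedges_subset_if_ft_hyperspanner_blowup:
  assumes t: "0 < t" "t ^ r \<le> Suc f"
    and B: "hypergraph B" "uniform r B" "2 \<le> r" "enat (2 * k + 1) \<le> girth B" "1 \<le> k"
    and V: "{x. x div t \<in> verts B} \<subseteq> V"
    and S: "ft_hyperspanner f (2 * real k - 1) (blowup t V B) S"
  shows "hedges (blowup t V B) \<subseteq> hedges S"
proof (rule subsetI, rule ccontr)
  let ?H = "blowup t V B" and ?p = "\<lambda>x. x div t"
  fix h assume hH: "h \<in> hedges ?H" and hS: "h \<notin> hedges S"
  define h0 where "h0 = ?p ` h"
  from hH have inj: "inj_on ?p h" and h0: "h0 \<in> hedges B" by (auto simp: h0_def)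
  have fin0: "finite h0" "card h0 = r" "h0 \<subseteq> verts B"
  proof -
    show sub0: "h0 \<subseteq> verts B" using B(1) h0 by (auto simp: hypergraph_def)
    show "finite h0" using B(1) by (intro finite_subset[OF sub0]) (simp add: hypergraph_def)
    show "card h0 = r" using B(2) h0 by (simp add: uniform_def)
  qed
  have hV: "h \<subseteq> V" using V fin0(3) by (auto simp: h0_def)
  have "card h = r" using fin0 card_image[OF inj] by (simp add: h0_def)
  with \<open>2 \<le> r\<close> have "finite h" "\<not> card h \<le> Suc 0" by (simp_all add: card_ge_0_finite)
  then obtain u v where uv: "u \<in> h" "v \<in> h" "u \<noteq> v"
    using card_le_Suc0_iff_eq[of h] by blast
  define E where "E = {e. inj_on ?p e \<and> ?p ` e = h0}"
  define F where "F = E - {h}"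
  have E: "finite E" "card E = t ^ r"
    using finite_transversals card_transversals t fin0 by (auto simp: E_def)
  moreover have "h \<in> E" using inj by (simp add: E_def h0_def)
  \<comment> \<open>Sparing \<open>h\<close> leaves \<open>t ^ r - 1\<close> faults, which is at
    most \<open>f\<close>.\<close>
  ultimately have F: "finite F" "card F \<le> f" using t by (auto simp: F_def card_Diff_singleton)
  have "F \<subseteq> hedges ?H" using h0 by (auto simp: F_def E_def)
  have sub: "sub_hypergraph S ?H" using S by (simp add: ft_hyperspanner_def)
  have "hdist (del_hedges ?H F) u v \<le> 1"
    using hH uv hV by (intro hdist_le_1[of h]) (auto simp: del_hedges_def F_def)
  then have "ereal (2 * real k - 1) * hdist (del_hedges ?H F) u v \<le> ereal (2 * real k - 1) * 1"
    using \<open>1 \<le> k\<close> by (intro ereal_mult_left_mono) auto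
  moreover have "hdist (del_hedges S F) u v
      \<le> ereal (2 * real k - 1) * hdist (del_hedges ?H F) u v"
  proof -
    have "\<forall>u \<in> V. \<forall>v \<in> V. \<forall>F \<subseteq> hedges ?H. finite F \<and> card F \<le> f \<longrightarrow>
        hdist (del_hedges S F) u v \<le> ereal (2 * real k - 1) * hdist (del_hedges ?H F) u v"
      using S unfolding ft_hyperspanner_def blowup_simps(1) by blast
    moreover have "u \<in> V" "v \<in> V" using uv hV by auto
    ultimately show ?thesis using F \<open>F \<subseteq> hedges ?H\<close> by blast
  qed
  ultimately have "hdist (del_hedges S F) u v \<le> ereal (2 * real k - 1)" by simp
  \<comment> \<open>The strict bound is needed to extract a path from the infimum. Since path
    lengths are integers here, being below \<open>2 * k\<close> still means at most
    \<open>2 * k - 1\<close>.\<close>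
  also have "\<dots> < ereal (2 * real k)" by simp
  finally have less: "hdist (del_hedges S F) u v < ereal (2 * real k)" .
  have "unweighted (del_hedges S F)"
    using sub by (auto simp: unweighted_def del_hedges_def sub_hypergraph_def)
  from hpath_of_hdist_less[OF this less] obtain xs hs where p: "hpath (del_hedges S F) u xs hs v"
    and "real (length hs) < 2 * real k" by blast
  then have len: "length hs < 2 * k" by linarith
  \<comment> \<open>Of the copies of \<open>h0\<close>, those in \<open>F\<close> are deleted and
    the remaining one, \<open>h\<close>, is missing from \<open>S\<close>.\<close>
  have edge: "e \<in> hedges ?H \<and> ?p ` e \<noteq> h0" if "e \<in> set hs" for e
  proof -
    have "e \<in> hedges S" "e \<notin> F" using p that by (auto simp: hpath_def del_hedges_def)
    moreover from this have "e \<in> hedges ?H" using sub by (auto simp: sub_hypergraph_def)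
    ultimately show ?thesis using hS by (auto simp: F_def E_def)
  qed
  have edgeB: "?p ` e \<in> hedges B - {h0}" if "e \<in> set hs" for e
    using edge[OF that] by auto
  \<comment> \<open>Every vertex of the path other than \<open>u\<close> lies on one of its hyperedges, so the path avoids
     the isolated vertices.\<close>
  have vert: "?p x \<in> verts B" if x: "x \<in> set xs" for x
  proof (cases "x = u")
    case True
    then show ?thesis using uv fin0(3) by (auto simp: h0_def)
  next
    case False
    from x obtain i where i: "i < length xs" "xs ! i = x" by (auto simp: in_set_conv_nth)
    have "xs \<noteq> []" "hd xs = u" using p by (auto simp: hpath_def)
    then have "i \<noteq> 0" using False i by (metis hd_conv_nth)
    then obtain j where j: "i = Suc j" by (cases i) auto
    then have "hs ! j \<in> set hs" "x \<in> hs ! j" using p i by (auto simp: hpath_def)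
    moreover have "?p ` (hs ! j) \<subseteq> verts B"
      using edgeB[OF \<open>hs ! j \<in> set hs\<close>] B(1) by (auto simp: hypergraph_def)
    ultimately show ?thesis by blast
  qed
  have "hpath (del_hedges B {h0}) (?p u) (map ?p xs) (map ((`) ?p) hs) (?p v)"
    unfolding hpath_def
  proof (intro conjI)
    have "xs \<noteq> []" using p by (auto simp: hpath_def)
    then show "hd (map ?p xs) = ?p u" "last (map ?p xs) = ?p v"
      using p by (auto simp: hpath_def hd_map last_map)
    show "set (map ((`) ?p) hs) \<subseteq> hedges (del_hedges B {h0})"
      using edgeB by (auto simp: del_hedges_def)
    show "\<forall>j < length (map ((`) ?p) hs). map ?p xs ! j \<in> map ((`) ?p) hs ! j \<and>
        map ?p xs ! Suc j \<in> map ((`) ?p) hs ! j"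
      using p by (auto simp: hpath_def)
  qed (use p vert in \<open>auto simp: hpath_def del_hedges_def\<close>)
  moreover have "?p u \<in> h0" "?p v \<in> h0"
    using uv by (simp_all add: h0_def)
  \<comment> \<open>The projection is injective on \<open>h\<close>, so the projected path does not
    collapse to a closed walk.\<close>
  moreover have "?p u \<noteq> ?p v"
    using uv inj by (meson inj_onD)
  ultimately have "girth B \<le> enat (Suc (length (map ((`) ?p) hs)))"
    using h0 by (intro girth_le_hpath)
  then have "girth B \<le> enat (Suc (length hs))" by simp
  from order_trans[OF B(4) this] len show False by simp
qed

section \<open>Counting hyperedges\<close>

text \<open>\<open>Max\<close> is attained only on a finite nonempty set. There are at most
  \<open>2 ^ n\<close> hyperedges on \<open>n\<close> vertices, and the edgeless hypergraph
  qualifies because its girth is infinite.\<close>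

lemma ex_max_hedges_girth:
  "\<exists>H :: nat hypergraph. hypergraph H \<and> card (verts H) = n \<and> uniform r H \<and> enat g \<le> girth H \<and>
     card (hedges H) = max_hedges_girth n r g"
proof -
  let ?P = "\<lambda>H :: nat hypergraph.
    hypergraph H \<and> card (verts H) = n \<and> uniform r H \<and> enat g \<le> girth H"
  let ?A = "{card (hedges H) | H. ?P H}"
  have "card (hedges H) \<le> 2 ^ n" if "?P H" for H
    using that card_mono[of "Pow (verts H)" "hedges H"] by (auto simp: hypergraph_def card_Pow)
  then have "?A \<subseteq> {..2 ^ n}" unfolding atMost_def by fast
  then have "finite ?A" by (rule finite_subset) simp
  moreover have "?P \<lparr>verts = {..<n}, hedges = {}, weight = (\<lambda>_. 1)\<rparr>"
  proof -
    have "girth \<lparr>verts = {..<n}, hedges = {}, weight = (\<lambda>_. 1)\<rparr> = \<infinity>"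
      by (auto simp: girth_def berge_cycle_def top_enat_def Inf_enat_def)
    then show ?thesis by (simp add: hypergraph_def uniform_def)
  qed
  then have "?A \<noteq> {}" by blast
  ultimately have "Max ?A \<in> ?A" by (rule Max_in)
  then show ?thesis unfolding max_hedges_girth_def by force
qed

text \<open>Split the indices at a point \<open>M\<close> beyond which
  \<open>\<bar>\<epsilon> m\<bar>\<close> is small. Later terms are at most a small multiple of
  \<open>ln n\<close>; the finitely many earlier ones are bounded by a constant that
  \<open>ln n\<close> eventually dominates.\<close>

lemma Max_abs_mult_ln_tendsto_0:
  assumes "\<epsilon> \<longlonglongrightarrow> (0 :: real)"
  shows "(\<lambda>n. Max ((\<lambda>m. \<bar>\<epsilon> m\<bar> * ln (real m)) ` {..n}) / ln (real n)) \<longlonglongrightarrow> 0"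
proof (rule LIMSEQ_I)
  let ?a = "\<lambda>m. \<bar>\<epsilon> m\<bar> * ln (real m)"
  fix d :: real assume d: "0 < d"
  from LIMSEQ_D[OF assms, of "d / 2"] d obtain M where M: "\<And>m. m \<ge> M \<Longrightarrow> \<bar>\<epsilon> m\<bar> < d / 2" by auto
  define K where "K = Max (?a ` {..M})"
  have "filterlim (\<lambda>n. ln (real n)) at_top sequentially"
    by (rule filterlim_compose[OF ln_at_top filterlim_real_sequentially])
  then have "\<forall>\<^sub>F n in sequentially. max 1 (2 * K / d) \<le> ln (real n)"
    unfolding filterlim_at_top by blast
  then obtain n0 where n0: "\<And>n. n \<ge> n0 \<Longrightarrow> max 1 (2 * K / d) \<le> ln (real n)"
    by (auto simp: eventually_sequentially)
  show "\<exists>no. \<forall>n\<ge>no. norm (Max (?a ` {..n}) / ln (real n) - 0) < d"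
  proof (intro exI allI impI)
    fix n assume n: "n \<ge> n0"
    have ln: "1 \<le> ln (real n)" "K \<le> d / 2 * ln (real n)"
      using n0[OF n] d by (auto simp: field_simps)
    have "?a m \<le> d / 2 * ln (real n)" if "m \<le> n" for m
    proof (cases "m \<le> M")
      case True
      then have "?a m \<le> K" unfolding K_def by (intro Max_ge) auto
      with ln show ?thesis by linarith
    next
      case False
      then have "\<bar>\<epsilon> m\<bar> \<le> d / 2" "1 \<le> m" using M[of m] by auto
      then show ?thesis using that by (intro mult_mono) auto
    qed
    then have "Max (?a ` {..n}) \<le> d / 2 * ln (real n)"
      by (intro Max.boundedI) blast+
    also have "\<dots> < d * ln (real n)" using ln d by simp
    finally have "Max (?a ` {..n}) / ln (real n) < d" using ln by (simp add: divide_less_eq)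
    \<comment> \<open>The index 0 contributes exactly 0, since \<open>ln 0 = 0\<close> by
      convention, so the maximum is nonnegative.\<close>
    moreover have "?a 0 \<le> Max (?a ` {..n})" by (intro Max_ge imageI) auto
    then have "0 \<le> Max (?a ` {..n}) / ln (real n)" using ln by auto
    ultimately show "norm (Max (?a ` {..n}) / ln (real n) - 0) < d" by simp
  qed
qed

text \<open>A single null sequence at \<open>n\<close> absorbs the error terms of all \<open>m \<le> n\<close>, including bounded \<open>m\<close>.
  This makes the final error term independent of the number of faults.\<close>

lemma uniform_null_sequence:
  assumes "\<epsilon> \<longlonglongrightarrow> (0 :: real)"
  obtains \<epsilon>' where "\<epsilon>' \<longlonglongrightarrow> (0 :: real)"
    "\<And>m n. 0 < m \<Longrightarrow> m \<le> n \<Longrightarrow> 2 \<le> n \<Longrightarrow> real n powr - \<epsilon>' n \<le> real m powr - \<epsilon> m"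
proof
  let ?a = "\<lambda>m. \<bar>\<epsilon> m\<bar> * ln (real m)"
  let ?e = "\<lambda>n. Max (?a ` {..n}) / ln (real n)"
  show "?e \<longlonglongrightarrow> 0" using assms by (rule Max_abs_mult_ln_tendsto_0)
  fix m n :: nat assume mn: "0 < m" "m \<le> n" "2 \<le> n"
  have "\<epsilon> m * ln (real m) \<le> ?a m" using mn by (intro mult_right_mono) auto
  also have "\<dots> \<le> Max (?a ` {..n})" using mn by (intro Max_ge) auto
  also have "\<dots> = ?e n * ln (real n)" using mn by simp
  finally have "- ?e n * ln (real n) \<le> - \<epsilon> m * ln (real m)" by linarith
  moreover have "real n \<noteq> 0" "real m \<noteq> 0" using mn by simp_all
  ultimately show "real n powr - ?e n \<le> real m powr - \<epsilon> m"
    unfolding powr_def by simp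
qed

text \<open>Take the floor of the real root of \<open>f\<close>. As that root is at least 1,
  rounding down loses less than a factor of 2.\<close>

lemma ex_integer_root:
  assumes "1 \<le> r" "1 \<le> f"
  obtains t :: nat where "1 \<le> t" "t ^ r \<le> f" "real f powr (1 / real r) \<le> 2 * real t"
proof -
  define z where "z = real f powr (1 / real r)"
  have z: "1 \<le> z" using assms by (simp add: z_def ge_one_powr_ge_zero)
  have zr: "z ^ r = real f"
    using assms z by (simp add: z_def powr_powr flip: powr_realpow)
  define t where "t = nat \<lfloor>z\<rfloor>"
  have t: "1 \<le> t" "real t \<le> z" "z < real t + 1"
    using z by (simp_all add: t_def le_nat_floor)
  have "real (t ^ r) \<le> real f"
    using power_mono[OF t(2), of r] by (simp add: zr)
  then have "t ^ r \<le> f" by simp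
  moreover have "z \<le> 2 * real t" using t by simp
  ultimately show ?thesis using that t(1) by (simp add: z_def)
qed

text \<open>With \<open>a = 1 + 1 / k\<close>, the exponent of \<open>f\<close> is
  \<open>(r - a) / r\<close>, so the power of \<open>f\<close> is at most
  \<open>(2 * t) powr (r - a)\<close>, while \<open>n powr a\<close> is at most
  \<open>(2 * m * t) powr a\<close>. The powers of \<open>2 * t\<close> combine to
  \<open>(2 * t) ^ r\<close>, whence the constant \<open>1 / 2 ^ r\<close>. The factor
  \<open>E\<close> stands for the error term.\<close>

lemma blowup_size_bound:
  fixes k r f t m n :: nat
  assumes "1 \<le> k" "2 \<le> r" "1 \<le> f" "1 \<le> t"
    and t: "real f powr (1 / real r) \<le> 2 * real t"
    and m: "real n \<le> 2 * real m * real t" and "0 \<le> E"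
  shows "1 / 2 ^ r * real f powr (1 - 1 / real r - 1 / (real r * real k)) *
           (real n powr (1 + 1 / real k) * E)
         \<le> real m powr (1 + 1 / real k) * E * real t ^ r"
proof -
  define a where "a = 1 + 1 / real k"
  \<comment> \<open>Both \<open>a\<close> and \<open>r - a\<close> must be nonnegative exponents for
    \<open>powr\<close> to be monotone in its base; \<open>a \<le> 2 \<le> r\<close> ensures the
    latter.\<close>
  have a: "0 \<le> a" "a \<le> real r"
  proof -
    have "1 / real k \<le> 1" using assms by simp
    then show "a \<le> real r" using assms unfolding a_def by linarith
  qed (simp add: a_def)
  have "real f powr (1 - 1 / real r - 1 / (real r * real k)) =
      (real f powr (1 / real r)) powr (real r - a)"
  proof -
    have "1 / real r * (real r - a) = 1 - 1 / real r - 1 / (real r * real k)"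
      using assms by (simp add: a_def field_simps)
    then show ?thesis by (simp only: powr_powr)
  qed
  also have "\<dots> \<le> (2 * real t) powr (real r - a)"
    using t a by (intro powr_mono2) auto
  finally have 1: "real f powr (1 - 1 / real r - 1 / (real r * real k)) \<le> (2 * real t) powr (real r - a)" .
  have "real n powr a \<le> (real m * (2 * real t)) powr a"
    using m a by (intro powr_mono2) (auto simp: mult_ac)
  also have "\<dots> = real m powr a * (2 * real t) powr a" by (simp add: powr_mult)
  finally have 2: "real n powr a \<le> real m powr a * (2 * real t) powr a" .
  have "real f powr (1 - 1 / real r - 1 / (real r * real k)) * real n powr a
      \<le> (2 * real t) powr (real r - a) * (real m powr a * (2 * real t) powr a)"
    by (intro mult_mono 1 2) auto
  also have "\<dots> = real m powr a * ((2 * real t) powr (real r - a) * (2 * real t) powr a)"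
    by simp
  also have "(2 * real t) powr (real r - a) * (2 * real t) powr a = (2 * real t) ^ r"
    using assms by (simp add: powr_realpow flip: powr_add)
  finally have "real f powr (1 - 1 / real r - 1 / (real r * real k)) * real n powr a
      \<le> 2 ^ r * (real m powr a * real t ^ r)" by (simp add: power_mult_distrib mult_ac)
  then have "real f powr (1 - 1 / real r - 1 / (real r * real k)) * real n powr a * E
      \<le> 2 ^ r * (real m powr a * real t ^ r) * E"
    using \<open>0 \<le> E\<close> by (rule mult_right_mono)
  then show ?thesis by (simp add: a_def field_simps)
qed

text \<open>Choosing \<open>c\<close>, \<open>C\<close> and \<open>\<epsilon>\<close> before
  \<open>f\<close> makes the bound uniform in the number of faults. The condition on
  \<open>N\<close> lets \<open>f\<close> grow up to the order of \<open>n ^ r\<close>, which is also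
  the order of the number of all \<open>r\<close>-sets of vertices.\<close>

theorem theorem2:
  assumes "spiro_verstraete_conjecture"
  shows "\<forall>k \<ge> (1::nat). \<forall>r \<ge> (2::nat).
    \<exists>c > (0::real). \<exists>C > (0::real). \<exists>\<epsilon> :: nat \<Rightarrow> real. \<epsilon> \<longlonglongrightarrow> 0 \<and>
      (\<forall>f \<ge> (1::nat). \<exists>N :: nat set.
        infinite N \<and> {n. C * real f \<le> real n ^ r} \<subseteq> N \<and>
        (\<forall>n \<in> N. \<exists>H :: nat hypergraph.
          hypergraph H \<and> unweighted H \<and> uniform r H \<and> card (verts H) = n \<and>
          real (card (hedges H)) \<ge>
            c * real f powr (1 - 1 / real r - 1 / (real r * real k)) *
              real n powr (1 + 1 / real k - \<epsilon> n) \<and>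
          (\<forall>S. ft_hyperspanner f (2 * real k - 1) H S \<longrightarrow> hedges H \<subseteq> hedges S)))"
proof (intro allI impI)
  fix k r :: nat assume k: "1 \<le> k" and r: "2 \<le> r"
  let ?g = "2 * k + 1 + 1"
  \<comment> \<open>The odd choice \<open>l = 2 * k + 1\<close> satisfies \<open>l \<ge> 3\<close> also for \<open>k = 1\<close>.\<close>
  have "\<exists>\<epsilon> :: nat \<Rightarrow> real. \<epsilon> \<longlonglongrightarrow> 0 \<and> (\<forall>\<^sub>F n in sequentially.
      real (max_hedges_girth n r ?g) = real n powr (1 + 1 / real ((2 * k + 1) div 2) - \<epsilon> n))"
  proof -
    have "3 \<le> 2 * k + 1" using k by simp
    with assms r show ?thesis unfolding spiro_verstraete_conjecture_def by fast
  qed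
  then obtain \<epsilon> where \<epsilon>: "\<epsilon> \<longlonglongrightarrow> 0" and "\<forall>\<^sub>F n in sequentially.
      real (max_hedges_girth n r ?g) = real n powr (1 + 1 / real k - \<epsilon> n)" by auto
  then obtain M0 where M0: "\<And>n. M0 \<le> n \<Longrightarrow>
      real (max_hedges_girth n r ?g) = real n powr (1 + 1 / real k - \<epsilon> n)"
    unfolding eventually_sequentially by blast
  \<comment> \<open>A base hypergraph on at least \<open>M\<close> vertices lies in the range of the
    conjectured formula; the 2 guarantees \<open>2 \<le> n\<close> for the comparison of error
    terms.\<close>
  define M where "M = max 2 M0"
  from uniform_null_sequence[OF \<epsilon>] obtain \<epsilon>' where \<epsilon>': "\<epsilon>' \<longlonglongrightarrow> 0"
    and le: "\<And>m n. 0 < m \<Longrightarrow> m \<le> n \<Longrightarrow> 2 \<le> n \<Longrightarrow> real n powr - \<epsilon>' n \<le> real m powr - \<epsilon> m" by blast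
  have build: "\<exists>H :: nat hypergraph.
          hypergraph H \<and> unweighted H \<and> uniform r H \<and> card (verts H) = n \<and>
          real (card (hedges H)) \<ge>
            1 / 2 ^ r * real f powr (1 - 1 / real r - 1 / (real r * real k)) *
              real n powr (1 + 1 / real k - \<epsilon>' n) \<and>
          (\<forall>S. ft_hyperspanner f (2 * real k - 1) H S \<longrightarrow> hedges H \<subseteq> hedges S)"
    if f: "1 \<le> f" and n: "real M ^ r * real f \<le> real n ^ r" for f n :: nat
  proof -
    obtain t :: nat where t: "1 \<le> t" "t ^ r \<le> f" "real f powr (1 / real r) \<le> 2 * real t"
      by (rule ex_integer_root[of r f]) (use r f in auto)
    \<comment> \<open>The assumption on \<open>n\<close> is a root-free form of
      \<open>M * f powr (1 / r) \<le> n\<close>; it leaves room for \<open>t\<close> copies of at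
      least \<open>M\<close> base vertices.\<close>
    have "real ((M * t) ^ r) \<le> real M ^ r * real f"
      using t(2) by (simp add: power_mult_distrib mult_left_mono flip: of_nat_power)
    with n have "real ((M * t) ^ r) \<le> real (n ^ r)" by simp
    then have "(M * t) ^ r \<le> n ^ r" by (simp only: of_nat_le_iff)
    then have Mt: "M * t \<le> n" using r by (simp add: power_mono_iff)
    define m where "m = n div t"
    have m: "M \<le> m" "m * t \<le> n"
      using Mt t(1) by (simp_all add: m_def less_eq_div_iff_mult_less_eq)
    have "m \<le> m * t" using t(1) by simp
    moreover have "2 \<le> M" by (simp add: M_def)
    ultimately have mn: "0 < m" "m \<le> n" "2 \<le> n" using m by linarith+
    \<comment> \<open>The remainder is below \<open>t \<le> m * t\<close>, so rounding
      \<open>n\<close> down to a multiple of \<open>t\<close> costs less than a factor of 2.\<close>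
    have "n = m * t + n mod t" by (simp add: m_def)
    moreover have "n mod t < t" using t(1) by simp
    moreover have "t \<le> m * t" using mn by simp
    ultimately have "n \<le> 2 * (m * t)" by linarith
    then have n2: "real n \<le> 2 * real m * real t"
      by (metis of_nat_le_iff of_nat_mult of_nat_numeral mult.assoc)
    obtain B :: "nat hypergraph" where B: "hypergraph B" "card (verts B) = m" "uniform r B"
      "enat ?g \<le> girth B" "card (hedges B) = max_hedges_girth m r ?g"
      using ex_max_hedges_girth by blast
    let ?W = "{x. x div t \<in> verts B}"
    have W: "finite ?W" "card ?W = m * t"
      using finite_div_vimage card_div_vimage t(1) B by (auto simp: hypergraph_def)
    \<comment> \<open>Isolated vertices from outside \<open>?W\<close> pad the vertex set to exactly
      \<open>n\<close> elements.\<close>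
    have "infinite (- ?W)" using W(1) by (simp add: finite_compl)
    then obtain D where D: "finite D" "card D = n - m * t" "D \<subseteq> - ?W"
      using infinite_arbitrarily_large by blast
    define V where "V = ?W \<union> D"
    have "?W \<inter> D = {}" using D(3) by blast
    then have V: "finite V" "?W \<subseteq> V" "card V = n"
      using W D m(2) by (auto simp: V_def card_Un_disjoint)
    let ?H = "blowup t V B"
    have "real n powr (1 + 1 / real k - \<epsilon>' n) = real n powr (1 + 1 / real k) * real n powr - \<epsilon>' n"
      by (simp flip: powr_add)
    \<comment> \<open>The conjecture is applied at \<open>m\<close>, which depends on
      \<open>f\<close>; the error term at \<open>n\<close> absorbs that at \<open>m\<close> and does
      not depend on \<open>f\<close>.\<close>
    also have "\<dots> \<le> real n powr (1 + 1 / real k) * real m powr - \<epsilon> m"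
      using le[OF mn] by (intro mult_left_mono) auto
    finally have "1 / 2 ^ r * real f powr (1 - 1 / real r - 1 / (real r * real k)) *
          real n powr (1 + 1 / real k - \<epsilon>' n)
        \<le> 1 / 2 ^ r * real f powr (1 - 1 / real r - 1 / (real r * real k)) *
          (real n powr (1 + 1 / real k) * real m powr - \<epsilon> m)"
      by (intro mult_left_mono) auto
    also have "\<dots> \<le> real m powr (1 + 1 / real k) * real m powr - \<epsilon> m * real t ^ r"
      using k r f t n2 by (intro blowup_size_bound) auto
    also have "\<dots> = real (card (hedges ?H))"
    proof -
      have "real (card (hedges B)) = real m powr (1 + 1 / real k - \<epsilon> m)"
        using M0[of m] m by (simp add: B(5) M_def)
      then show ?thesis
        using t B by (simp add: card_hedges_blowup del: blowup_simps flip: powr_add)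
    qed
    finally have "1 / 2 ^ r * real f powr (1 - 1 / real r - 1 / (real r * real k)) *
          real n powr (1 + 1 / real k - \<epsilon>' n) \<le> real (card (hedges ?H))" .
    moreover have "hedges ?H \<subseteq> hedges S" if "ft_hyperspanner f (2 * real k - 1) ?H S" for S
    proof (rule hedges_subset_if_ft_hyperspanner_blowup[OF _ _ B(1) B(3) r _ k V(2) that])
      have "enat (2 * k + 1) \<le> enat ?g" by simp
      then show "enat (2 * k + 1) \<le> girth B" using B(4) by (rule order_trans)
    qed (use t in auto)
    moreover have "unweighted ?H" by (simp add: unweighted_def)
    ultimately show ?thesis
      using hypergraph_blowup[OF B(1) V(1,2)] uniform_blowup[OF B(3)] V(3)
      by (intro exI[of _ ?H]) (simp del: blowup_simps(2))
  qed
  have inf: "infinite {n. real M ^ r * real f \<le> real n ^ r}" for f :: nat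
    unfolding infinite_nat_iff_unbounded_le
  proof
    fix b :: nat
    \<comment> \<open>\<open>Suc f\<close> is at least 1 even for \<open>f = 0\<close>, so its
      \<open>r\<close>-th power is at least \<open>Suc f\<close> and hence at least
      \<open>f\<close>.\<close>
    define n where "n = max b (M * Suc f)"
    have "real M ^ r * real f \<le> real M ^ r * real (Suc f) ^ r"
      using r self_le_power[of "real (Suc f)" r] by (intro mult_left_mono) auto
    also have "\<dots> = real (M * Suc f) ^ r" by (simp only: of_nat_mult power_mult_distrib)
    also have "\<dots> \<le> real n ^ r" by (intro power_mono) (simp_all only: n_def of_nat_le_iff max.cobounded2 of_nat_0_le_iff)
    finally show "\<exists>n\<ge>b. n \<in> {n. real M ^ r * real f \<le> real n ^ r}"
      by (intro exI[of _ n]) (simp add: n_def)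
  qed
  have M: "0 < real M ^ r" by (intro zero_less_power) (simp add: M_def)
  have c: "0 < 1 / (2 :: real) ^ r" by simp
  show "\<exists>c > (0::real). \<exists>C > (0::real). \<exists>\<epsilon> :: nat \<Rightarrow> real. \<epsilon> \<longlonglongrightarrow> 0 \<and>
      (\<forall>f \<ge> (1::nat). \<exists>N :: nat set.
        infinite N \<and> {n. C * real f \<le> real n ^ r} \<subseteq> N \<and>
        (\<forall>n \<in> N. \<exists>H :: nat hypergraph.
          hypergraph H \<and> unweighted H \<and> uniform r H \<and> card (verts H) = n \<and>
          real (card (hedges H)) \<ge>
            c * real f powr (1 - 1 / real r - 1 / (real r * real k)) *
              real n powr (1 + 1 / real k - \<epsilon> n) \<and>
          (\<forall>S. ft_hyperspanner f (2 * real k - 1) H S \<longrightarrow> hedges H \<subseteq> hedges S)))"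
  proof (rule exI[of _ "1 / 2 ^ r"], rule conjI[OF c], rule exI[of _ "real M ^ r"],
      rule conjI[OF M], rule exI[of _ \<epsilon>'], rule conjI[OF \<epsilon>'], intro allI impI, goal_cases)
    case f: (1 f)
    show ?case
      by (rule exI[of _ "{n. real M ^ r * real f \<le> real n ^ r}"])
        (intro conjI inf subset_refl ballI build[OF f], simp)
  qed
qed

end
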